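(* Let $\varsigma$ be the $\mathbb Z$-action $\varsigma^z(t)=t+z\alpha$ on $\mathbf T$, and let $\mathcal P=\{P_0,P_1\}$ be an open partition of $\mathbf T$ with $\lceil\partial\mathcal P\rceil_L<\infty$. If $\varsigma$ is dyadically recurrent, then the quasisturmian measure $\mu=\Upsilon_\varsigma(\mathcal P)$ on $\{0,1\}^{\mathbb Z}$ is dyadically recurrent.
   Context: $K\ge1$, $\mathbf T=(\mathbb R/\mathbb Z)^K$ with usual metric $d$ and Lebesgue (Haar) probability measure $\lambda$; $\alpha\in\mathbf T$ is such that $z\mapsto z\alpha$ is injective with dense image. $\mathcal A=\mathbb Z/2=\{0,1\}$. An open partition is a pair $\mathcal P=\{P_0,P_1\}$ of disjoint open subsets of $\mathbf T$ with $P_*:=P_0\sqcup P_1$ dense and $\lambda(P_* )=1$; $\partial\mathcal P=\partial P_0\cup\partial P_1$. For $\lambda$-a.e. $t$, $\mathcal P_\varsigma(t)\in\{0,1\}^{\mathbb Z}$ has $z$-th entry the unique $a$ with $\varsigma^z(t)\in P_a$; $\Upsilon_\varsigma(\mathcal P)$ is the push-forward of $\lambda$ under $\mathcal P_\varsigma$. For closed $C\subset\mathbf T$, $\lceil C\rceil_L:=\lim_{\epsilon\to0^+}\frac1{2\epsilon}\lambda(\{t\in\mathbf T:d(t,c)<\epsilon\text{ for some }c\in C\})$; "$\lceil C\rceil_L<\infty$" means this limit exists and is finite. The action $\varsigma$ is dyadically recurrent if there is a sequence of natural numbers $n_k\to\infty$ with $d(\varsigma^{2^{n_k}}(t),t)<2^{-n_k}$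 for all $t\in\mathbf T$ and all $k$. A Borel probability measure $\mu$ on $\{0,1\}^{\mathbb Z}$ is dyadically recurrent if there are a sequence of natural numbers $n_k\to\infty$ and constants $\epsilon,\delta>0$ such that $\mu[\mathfrak R_k]>\epsilon$ for all $k$, where $\mathfrak R_k=\{\mathbf a: a_\ell=a_{\ell+2^{n_k}}\text{ for all integers }0\le\ell<\delta2^{n_k}\}$. *)

theory Defs
  imports "HOL-Probability.Probability" "HOL-Library.Z2"
begin

quotient_type circle = real / "\<lambda>x y. x - y \<in> \<int>"
proof (rule equivpI)
  show "reflp (\<lambda>x y::real. x - y \<in> \<int>)"
    by (simp add: reflp_def)
  show "symp (\<lambda>x y::real. x - y \<in> \<int>)"
    by (metis (no_types, lifting) Ints_minus minus_diff_eq sympI)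
  show "transp (\<lambda>x y::real. x - y \<in> \<int>)"
    by (rule transpI) (metis Ints_add add_diff_eq diff_add_cancel)
qed

lemma Ints_eq_diffI: "x \<in> \<int> \<Longrightarrow> y = x \<Longrightarrow> (y::real) \<in> \<int>"
  by simp

instantiation circle :: ab_group_add
begin

lift_definition zero_circle :: circle is "0 :: real" .

lift_definition plus_circle :: "circle \<Rightarrow> circle \<Rightarrow> circle" is "(+) :: real \<Rightarrow> _"
  by (drule (1) Ints_add, erule Ints_eq_diffI, simp)

lift_definition minus_circle :: "circle \<Rightarrow> circle \<Rightarrow> circle" is "(-) :: real \<Rightarrow> _"
  by (drule (1) Ints_diff, erule Ints_eq_diffI, simp)

lift_definition uminus_circle :: "circle \<Rightarrow> circle" is "uminus :: real \<Rightarrow> _"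
  by (drule Ints_minus, erule Ints_eq_diffI, simp)

instance
  by standard (transfer, simp add: algebra_simps)+

end

lemma dist_nearest_int_periodic:
  fixes x y :: real
  assumes "x - y \<in> \<int>"
  shows "\<bar>x - of_int (round x)\<bar> = \<bar>y - of_int (round y)\<bar>"
proof -
  from assms obtain k where k: "x = y + of_int k"
    by (metis Ints_cases add.commute diff_add_cancel)
  have "round x = round y + k"
    by (simp add: k round_def add.assoc add.commute)
       (metis add.assoc add.commute floor_add_int)
  then show ?thesis by (simp add: k)
qed

instantiation circle :: metric_space
begin

text \<open>The quotient metric of \<open>\<real>/\<int>\<close>: the distance from \<open>x - y\<close> to the nearest integer.\<close>

lift_definition dist_circle :: "circle \<Rightarrow> circle \<Rightarrow> real"
  is "\<lambda>x y. \<bar>(x - y) - of_int (round (x - y))\<bar>"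
  by (rule dist_nearest_int_periodic, drule (1) Ints_diff, erule Ints_eq_diffI, simp)

definition uniformity_circle :: "(circle \<times> circle) filter"
  where "uniformity_circle = (INF e\<in>{0<..}. principal {(x, y). dist x y < e})"

definition open_circle :: "circle set \<Rightarrow> bool"
  where "open_circle U \<longleftrightarrow> (\<forall>x\<in>U. \<forall>\<^sub>F (x', y) in uniformity. x' = x \<longrightarrow> y \<in> U)"

instance
proof
  fix x y z :: circle
  show "dist x y = 0 \<longleftrightarrow> x = y"
    by transfer (metis Ints_cases Ints_of_int abs_0_eq abs_eq_0 eq_iff_diff_eq_0 round_of_int)
  show "dist x y \<le> dist x z + dist y z"
  proof transfer
    fix x y z :: real
    have "\<bar>(x - y) - of_int (round (x - y))\<bar>
        \<le> \<bar>(x - y) - of_int (round (x - z) - round (y - z))\<bar>"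
      by (rule round_diff_minimal)
    also have "\<dots> \<le> \<bar>(x - z) - of_int (round (x - z))\<bar> + \<bar>(y - z) - of_int (round (y - z))\<bar>"
      by simp
    finally show "\<bar>(x - y) - of_int (round (x - y))\<bar>
        \<le> \<bar>(x - z) - of_int (round (x - z))\<bar> + \<bar>(y - z) - of_int (round (y - z))\<bar>" .
  qed
qed (rule uniformity_circle_def open_circle_def)+

end

lift_definition to_circle :: "real \<Rightarrow> circle" is "\<lambda>x. x" .

text \<open>
  The torus \<open>(\<real>/\<int>)\<^sup>K\<close> is the type \<open>circle ^ 'n\<close> with \<open>K = CARD('n)\<close>.  The product metric
  of the library is the Euclidean combination of the coordinate distances, that is, the quotient
  metric of \<open>\<real>\<^sup>K/\<int>\<^sup>K\<close>.
\<close>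

definition to_torus :: "real ^ 'n \<Rightarrow> circle ^ 'n::finite"
  where "to_torus x = (\<chi> i. to_circle (x $ i))"

definition unit_cube :: "(real ^ 'n::finite) set"
  where "unit_cube = {x. \<forall>i. 0 \<le> x $ i \<and> x $ i < 1}"

text \<open>Haar measure: the image of Lebesgue measure on a fundamental domain.\<close>

definition torus_measure :: "(circle ^ 'n::finite) measure"
  where "torus_measure = distr (restrict_space lborel unit_cube) borel to_torus"

definition int_mult :: "int \<Rightarrow> 'a::ab_group_add \<Rightarrow> 'a"
  where "int_mult z a = (\<Sum>i<nat z. a) - (\<Sum>i<nat (- z). a)"

definition translation_action :: "'a::ab_group_add \<Rightarrow> int \<Rightarrow> 'a \<Rightarrow> 'a"
  where "translation_action \<alpha> z t = t + int_mult z \<alpha>"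

definition open_partition :: "(bit \<Rightarrow> (circle ^ 'n::finite) set) \<Rightarrow> bool"
  where "open_partition P \<longleftrightarrow>
    (\<forall>a. open (P a)) \<and> P 0 \<inter> P 1 = {} \<and> closure (P 0 \<union> P 1) = UNIV \<and>
    measure torus_measure (P 0 \<union> P 1) = 1"

definition partition_boundary :: "(bit \<Rightarrow> 'a::topological_space set) \<Rightarrow> 'a set"
  where "partition_boundary P = frontier (P 0) \<union> frontier (P 1)"

definition has_L_content :: "(circle ^ 'n::finite) set \<Rightarrow> real \<Rightarrow> bool"
  where "has_L_content C L \<longleftrightarrow>
    ((\<lambda>\<epsilon>. 1 / (2 * \<epsilon>) * measure torus_measure {t. \<exists>c\<in>C. dist t c < \<epsilon>}) \<longlongrightarrow> L) (at_right 0)"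

definition finite_L_content :: "(circle ^ 'n::finite) set \<Rightarrow> bool"
  where "finite_L_content C \<longleftrightarrow> (\<exists>L. has_L_content C L)"

abbreviation sequence_space :: "(int \<Rightarrow> bit) measure"
  where "sequence_space \<equiv> Pi\<^sub>M UNIV (\<lambda>_. count_space UNIV)"

text \<open>
  If the orbit of \<open>t\<close> leaves \<open>P 0 \<union> P 1\<close> at time \<open>z\<close>, which happens only for \<open>t\<close> in a null set,
  then the entry at \<open>z\<close> is a fixed unspecified symbol.
\<close>

definition itinerary :: "(int \<Rightarrow> 'a \<Rightarrow> 'a) \<Rightarrow> (bit \<Rightarrow> 'a set) \<Rightarrow> 'a \<Rightarrow> int \<Rightarrow> bit"
  where "itinerary \<sigma> P t = (\<lambda>z. THE a. \<sigma> z t \<in> P a)"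

definition partition_measure ::
    "(int \<Rightarrow> circle ^ 'n \<Rightarrow> circle ^ 'n) \<Rightarrow> (bit \<Rightarrow> (circle ^ 'n::finite) set) \<Rightarrow> (int \<Rightarrow> bit) measure"
  where "partition_measure \<sigma> P = distr torus_measure sequence_space (itinerary \<sigma> P)"

definition dyadically_recurrent_action :: "(int \<Rightarrow> 'a::metric_space \<Rightarrow> 'a) \<Rightarrow> bool"
  where "dyadically_recurrent_action \<sigma> \<longleftrightarrow>
    (\<exists>n::nat \<Rightarrow> nat. filterlim n at_top sequentially \<and>
      (\<forall>k t. dist (\<sigma> (2 ^ n k) t) t < 1 / 2 ^ n k))"

definition dyadic_return_set :: "real \<Rightarrow> nat \<Rightarrow> (int \<Rightarrow> bit) set"
  where "dyadic_return_set \<delta> m =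
    {a. \<forall>l::int. 0 \<le> l \<and> of_int l < \<delta> * 2 ^ m \<longrightarrow> a l = a (l + 2 ^ m)}"

definition dyadically_recurrent_measure :: "(int \<Rightarrow> bit) measure \<Rightarrow> bool"
  where "dyadically_recurrent_measure \<mu> \<longleftrightarrow>
    (\<exists>(n::nat \<Rightarrow> nat) \<epsilon> \<delta>. filterlim n at_top sequentially \<and> \<epsilon> > 0 \<and> \<delta> > 0 \<and>
      (\<forall>k. measure \<mu> (dyadic_return_set \<delta> (n k)) > \<epsilon>))"

lemma to_circle_add: "to_circle (x + y) = to_circle x + to_circle y"
  by transfer simp

lemma dist_to_circle_le: "dist (to_circle x) (to_circle y) \<le> dist x y"
  unfolding dist_real_def by transfer (metis diff_zero of_int_0 round_diff_minimal)

lemma continuous_on_to_circle [continuous_intros]: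
  "continuous_on S f \<Longrightarrow> continuous_on S (\<lambda>x. to_circle (f x))"
proof (rule continuous_on_compose2[of UNIV to_circle])
  show "continuous_on UNIV to_circle"
    unfolding continuous_on_iff by (meson dist_to_circle_le le_less_trans)
qed auto

lemma continuous_on_to_torus: "continuous_on S to_torus"
  unfolding to_torus_def by (intro continuous_intros)

lemma surj_to_torus_unit_cube: "to_torus ` unit_cube = UNIV"
proof -
  have "\<exists>x\<in>unit_cube. t = to_torus x" for t :: "circle ^ 'n"
  proof -
    have "\<exists>x. 0 \<le> x \<and> x < 1 \<and> to_circle x = c" for c
    proof transfer
      fix c :: real
      show "\<exists>x. 0 \<le> x \<and> x < 1 \<and> x - c \<in> \<int>"
        by (rule exI[of _ "frac c"]) (use frac_lt_1[of c] in \<open>simp add: frac_def\<close>)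
    qed
    then obtain g where g: "\<And>c. 0 \<le> g c \<and> g c < 1 \<and> to_circle (g c) = c"
      by metis
    show ?thesis
      by (rule bexI[of _ "\<chi> i. g (t $ i)"]) (simp_all add: g to_torus_def unit_cube_def)
  qed
  then show ?thesis by auto
qed

lemma emeasure_unit_cube: "emeasure lborel (unit_cube :: (real ^ 'n::finite) set) = 1"
  and sets_unit_cube: "(unit_cube :: (real ^ 'n::finite) set) \<in> sets borel"
proof -
  let ?C = "unit_cube :: (real ^ 'n) set"
  have "?C = (\<Inter>i. {x. 0 \<le> x $ i} \<inter> {x. x $ i < 1})"
    by (auto simp: unit_cube_def)
  also have "\<dots> \<in> sets borel"
    by (intro sets.countable_INT' sets.Int borel_closed borel_open
        closed_Collect_le open_Collect_less continuous_intros) (auto simp: countable_finite)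
  finally show meas: "?C \<in> sets borel" .
  have le: "(0::real ^ 'n) \<bullet> b \<le> 1 \<bullet> b" and eq: "(1 - 0::real ^ 'n) \<bullet> b = 1"
    if "b \<in> Basis" for b
    using that by (auto simp: Basis_vec_def inner_axis)
  have "emeasure lborel (box 0 (1::real ^ 'n)) = 1"
    using le eq by (subst emeasure_lborel_box) auto
  moreover have "emeasure lborel (cbox 0 (1::real ^ 'n)) = 1"
    using le eq by (subst emeasure_lborel_cbox) auto
  moreover have "emeasure lborel (box 0 (1::real ^ 'n)) \<le> emeasure lborel ?C"
    using meas by (intro emeasure_mono) (auto simp: unit_cube_def mem_box_cart intro: less_imp_le)
  moreover have "emeasure lborel ?C \<le> emeasure lborel (cbox 0 (1::real ^ 'n))"
    by (intro emeasure_mono) (auto simp: unit_cube_def mem_box_cart less_imp_le)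
  ultimately show "emeasure lborel ?C = 1" by simp
qed

lemma sets_torus_measure [simp, measurable_cong]: "sets torus_measure = sets borel"
  and space_torus_measure [simp]: "space torus_measure = UNIV"
  by (simp_all add: torus_measure_def)

lemma prob_space_torus_measure: "prob_space (torus_measure :: (circle ^ 'n::finite) measure)"
  unfolding torus_measure_def
proof (rule prob_space.prob_space_distr)
  show "prob_space (restrict_space lborel (unit_cube :: (real ^ 'n) set))"
    by (rule prob_spaceI)
       (simp add: emeasure_restrict_space sets_unit_cube emeasure_unit_cube space_restrict_space)
  show "to_torus \<in> restrict_space lborel (unit_cube :: (real ^ 'n) set) \<rightarrow>\<^sub>M borel"
    by (intro measurable_restrict_space1)
       (simp add: borel_measurable_continuous_onI continuous_on_to_torus)
qed

lemma int_mult_to_circle: "int_mult z (to_circle x) = to_circle (of_int z * x)"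
proof -
  have sum: "(\<Sum>i<n. to_circle x) = to_circle (of_nat n * x)" for n :: nat
    by (induction n) (simp_all add: to_circle_add algebra_simps, transfer, simp)
  have diff: "to_circle a - to_circle b = to_circle (a - b)" for a b
    by transfer simp
  show ?thesis
    unfolding int_mult_def sum diff by (cases "0 \<le> z") (simp_all add: algebra_simps)
qed

lemma continuous_on_translation_action:
  "continuous_on S (translation_action (\<alpha> :: circle ^ 'n::finite) z)"
proof -
  have "dist (x + c) (y + c) = dist x y" for x y c :: circle
    by transfer simp
  then have "dist (translation_action \<alpha> z s) (translation_action \<alpha> z t) = dist s t" for s t
    by (simp add: translation_action_def dist_vec_def)
  then show ?thesis
    unfolding continuous_on_iff by metis
qed

lemma measurable_itinerary:
  fixes P :: "bit \<Rightarrow> (circle ^ 'n::finite) set"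
  assumes "open_partition P"
  shows "itinerary (translation_action \<alpha>) P \<in> torus_measure \<rightarrow>\<^sub>M sequence_space"
proof (rule measurable_PiM_single')
  fix z :: int
  define d where "d = (THE a::bit. False)"
  have P: "P a \<in> sets borel" for a
    using assms by (simp add: open_partition_def)
  have The: "(THE a. s \<in> P a) = (if s \<in> P 0 then 0 else if s \<in> P 1 then 1 else d)" for s
  proof -
    have "s \<in> P 0 \<Longrightarrow> (THE a. s \<in> P a) = 0" "s \<in> P 1 \<Longrightarrow> (THE a. s \<in> P a) = 1"
      using assms by (auto simp: open_partition_def intro!: the_equality)
    moreover have "s \<notin> P 0 \<Longrightarrow> s \<notin> P 1 \<Longrightarrow> (\<lambda>a. s \<in> P a) = (\<lambda>a. False)"
      by (metis bit.exhaust)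
    ultimately show ?thesis by (auto simp: d_def)
  qed
  have "(\<lambda>s. THE a. s \<in> P a) \<in> borel \<rightarrow>\<^sub>M count_space UNIV"
    unfolding The using P by measurable
  moreover have "translation_action \<alpha> z \<in> borel \<rightarrow>\<^sub>M borel"
    by (simp add: borel_measurable_continuous_onI continuous_on_translation_action)
  ultimately show "(\<lambda>t. itinerary (translation_action \<alpha>) P t z) \<in> torus_measure \<rightarrow>\<^sub>M count_space UNIV"
    unfolding itinerary_def by measurable
qed (auto simp: PiE_def)

lemma prob_space_partition_measure:
  "open_partition P \<Longrightarrow> prob_space (partition_measure (translation_action \<alpha>) P)"
  unfolding partition_measure_def
  by (intro prob_space.prob_space_distr prob_space_torus_measure measurable_itinerary)

end

theory Submission
  imports Defs
begin

text \<open>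
  Write \<open>N = 2\<^sup>m\<close> for one of the recurrence times of the action, and let \<open>C\<close> be the boundary of
  the partition.  Translation by \<open>N\<alpha>\<close> moves every point by less than \<open>1/N\<close>.  If the itinerary
  of \<open>t\<close> has different symbols at the times \<open>l\<close> and \<open>l + N\<close>, then the points of the orbit at
  these times are told apart by some \<open>P a\<close>, so the short segment joining them crosses the
  frontier of \<open>P a\<close>, and \<open>t + l\<alpha>\<close> lies within \<open>1/N\<close> of \<open>C\<close>
  (\<open>itinerary_changes_near_boundary\<close>).  Hence the points \<open>t\<close> whose itinerary does not belong to
  the return set are covered by one translate of the \<open>1/N\<close>-neighbourhood of \<open>C\<close> for each integer
  \<open>0 \<le> l < \<delta>N\<close>.

  Haar measure is translation invariant (\<open>measure_torus_translate\<close>), and since the content of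
  \<open>C\<close> is finite, that neighbourhood has measure at most \<open>2M/N\<close> for some constant \<open>M\<close> and all large
  \<open>N\<close>.  There are at most \<open>\<delta>N + 1\<close> translates, so the exceptional set has measure at most
  \<open>2M\<delta> + 2M/N\<close>: the factors \<open>N\<close> cancel, and a small \<open>\<delta>\<close> keeps the bound below a constant smaller
  than one, uniformly in \<open>N\<close>.
\<close>

section \<open>The covering of the torus by Euclidean space\<close>

lemma to_torus_add: "to_torus (x + y) = to_torus x + to_torus y"
  by (simp add: to_torus_def vec_eq_iff to_circle_add)

lemma to_torus_zero: "to_torus 0 = 0"
proof -
  have "to_circle 0 = 0" by transfer simp
  then show ?thesis by (simp add: to_torus_def vec_eq_iff)
qed

lemma surj_to_torus: "surj to_torus"
  using surj_to_torus_unit_cube by blast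

lemma borel_measurable_to_torus: "to_torus \<in> borel \<rightarrow>\<^sub>M borel"
  by (rule borel_measurable_continuous_onI[OF continuous_on_to_torus])

lemma dist_to_torus_le: "dist (to_torus x) (to_torus y) \<le> dist x y"
  unfolding dist_vec_def to_torus_def
  by (auto intro!: L2_set_mono dist_to_circle_le)

lemma dist_torus_translate: "dist (s + u) (s + w) = dist u (w :: circle ^ 'n::finite)"
proof -
  have "dist (c + x) (c + y) = dist x y" for x y c :: circle
    by transfer simp
  then show ?thesis by (simp add: dist_vec_def)
qed

text \<open>
  The preimage whose coordinates all lie in \<open>[-1/2, 1/2]\<close> realises the distance to the origin;
  it is the vector along which nearby points of the torus are joined by a segment.
\<close>

lemma shortest_lift:
  fixes u :: "circle ^ 'n::finite"
  obtains b where "to_torus b = u" "norm b = dist u 0"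
proof -
  have "\<exists>r. to_circle r = c \<and> \<bar>r\<bar> = dist c 0" for c
  proof transfer
    fix c :: real
    show "\<exists>r. r - c \<in> \<int> \<and> \<bar>r\<bar> = \<bar>c - 0 - of_int (round (c - 0))\<bar>"
      by (rule exI[of _ "c - of_int (round c)"]) simp
  qed
  then obtain r where r: "\<And>c. to_circle (r c) = c" "\<And>c. \<bar>r c\<bar> = dist c 0"
    by metis
  show ?thesis
  proof (rule that)
    show "to_torus (\<chi> i. r (u $ i)) = u"
      by (simp add: to_torus_def r vec_eq_iff)
    show "norm (\<chi> i. r (u $ i)) = dist u 0"
      by (simp add: norm_vec_def dist_vec_def r)
  qed
qed

lemma int_mult_to_torus:
  "int_mult z (to_torus x) = to_torus (of_int z *\<^sub>R (x :: real ^ 'n::finite))"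
proof -
  have "int_mult z (to_torus x) $ i = int_mult z (to_circle (x $ i))" for i
    by (simp add: int_mult_def to_torus_def sum_component)
  then show ?thesis
    by (simp add: vec_eq_iff int_mult_to_circle) (simp add: to_torus_def)
qed

lemma translation_action_add:
  fixes \<alpha> :: "circle ^ 'n::finite"
  shows "translation_action \<alpha> (l + z) t = translation_action \<alpha> z (translation_action \<alpha> l t)"
proof -
  obtain x where "\<alpha> = to_torus x"
    using surj_to_torus by (metis surjD)
  then show ?thesis
    by (simp add: translation_action_def int_mult_to_torus scaleR_add_left to_torus_add add.assoc)
qed

section \<open>Translation invariance of Haar measure\<close>

definition lattice_point :: "('n \<Rightarrow> int) \<Rightarrow> real ^ 'n::finite"
  where "lattice_point k = (\<chi> i. of_int (k i))"

lemma to_torus_add_lattice_point: "to_torus (x + lattice_point k) = to_torus x"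
proof -
  have "to_circle (r + of_int j) = to_circle r" for r j
    by transfer simp
  then show ?thesis by (simp add: to_torus_def lattice_point_def vec_eq_iff)
qed

lemma add_lattice_point_in_unit_cube_iff:
  "x + lattice_point k \<in> unit_cube \<longleftrightarrow> k = (\<lambda>i. - \<lfloor>x $ i\<rfloor>)"
proof -
  have "0 \<le> x $ i + of_int (k i) \<and> x $ i + of_int (k i) < 1 \<longleftrightarrow> k i = - \<lfloor>x $ i\<rfloor>" for i
    by linarith
  then show ?thesis by (simp add: unit_cube_def lattice_point_def fun_eq_iff)
qed

lemma diff_lattice_point_in_unit_cube_iff:
  "x - lattice_point k \<in> unit_cube \<longleftrightarrow> k = (\<lambda>i. \<lfloor>x $ i\<rfloor>)"
proof -
  have "0 \<le> x $ i - of_int (k i) \<and> x $ i - of_int (k i) < 1 \<longleftrightarrow> k i = \<lfloor>x $ i\<rfloor>" for i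
    by linarith
  then show ?thesis by (simp add: unit_cube_def lattice_point_def fun_eq_iff)
qed

lemma emeasure_torus:
  assumes "B \<in> sets borel"
  shows "emeasure torus_measure B = emeasure lborel (to_torus -` B \<inter> unit_cube)"
proof -
  have "to_torus \<in> restrict_space lborel unit_cube \<rightarrow>\<^sub>M borel"
    by (intro measurable_restrict_space1) (simp add: borel_measurable_to_torus)
  moreover have "to_torus -` B \<inter> unit_cube \<in> sets borel"
    using measurable_sets[OF borel_measurable_to_torus assms] sets_unit_cube by auto
  ultimately show ?thesis
    unfolding torus_measure_def using assms
    by (subst emeasure_distr)
      (auto simp: space_restrict_space emeasure_restrict_space sets_unit_cube)
qed

lemma emeasure_lborel_translate:
  fixes c :: "'a::euclidean_space"
  assumes "A \<in> sets borel"
  shows "emeasure lborel ((\<lambda>x. x + c) -` A) = emeasure lborel A"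
proof -
  have "emeasure lborel A = emeasure (distr lborel borel ((+) c)) A"
    by (simp add: lborel_distr_plus)
  also have "\<dots> = emeasure lborel ((+) c -` A)"
    using assms by (simp add: emeasure_distr)
  also have "(+) c = (\<lambda>x. x + c)"
    by (simp add: fun_eq_iff add.commute)
  finally show ?thesis ..
qed

text \<open>
  The unit cube and its translate by \<open>v\<close> are both fundamental domains of the lattice, so they are
  cut into countably many pieces that correspond by lattice translations; these preserve both
  Lebesgue measure and every set pulled back from the torus.  Below, \<open>F k\<close> is such a piece of the
  cube, and \<open>E k\<close> is the corresponding piece of the translated cube, moved back by \<open>v\<close>.
\<close>

lemma emeasure_torus_translate:
  fixes B :: "(circle ^ 'n::finite) set"
  assumes B: "B \<in> sets borel"
  shows "emeasure torus_measure ((\<lambda>t. t + to_torus v) -` B) = emeasure torus_measure B"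
proof -
  define A where "A = to_torus -` B"
  have A: "A \<in> sets borel"
    unfolding A_def using measurable_sets[OF borel_measurable_to_torus B] by simp
  have periodic: "x + lattice_point k \<in> A \<longleftrightarrow> x \<in> A" for x k
    by (simp add: A_def to_torus_add_lattice_point)
  define E where "E k = {x \<in> unit_cube. x + v + lattice_point k \<in> A \<inter> unit_cube}" for k
  define F where "F k = {y \<in> A \<inter> unit_cube. y - v - lattice_point k \<in> unit_cube}" for k
  have F: "F k \<in> sets borel" for k
  proof -
    have "F k = A \<inter> unit_cube \<inter> (\<lambda>y. y - v - lattice_point k) -` unit_cube"
      by (auto simp: F_def)
    moreover have "(\<lambda>y. y - v - lattice_point k) -` unit_cube \<in> sets borel"
      using measurable_sets[of "\<lambda>y. y - v - lattice_point k" borel borel unit_cube]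
      by (simp add: sets_unit_cube)
    ultimately show ?thesis using A sets_unit_cube by auto
  qed
  have E_eq: "E k = (\<lambda>x. x + (v + lattice_point k)) -` F k" for k
    by (auto simp: E_def F_def add.assoc algebra_simps)
  have E: "E k \<in> sets borel" for k
    unfolding E_eq
    using measurable_sets[of "\<lambda>x. x + (v + lattice_point k)" borel borel "F k"] F by simp
  have translate: "(\<lambda>t. t + to_torus v) -` B \<in> sets borel"
  proof -
    have "continuous_on UNIV (\<lambda>t. t + to_torus v)"
      unfolding continuous_on_iff by (metis add.commute dist_torus_translate)
    from measurable_sets[OF borel_measurable_continuous_onI[OF this] B] show ?thesis by simp
  qed
  have "to_torus -` (\<lambda>t. t + to_torus v) -` B \<inter> unit_cube = (\<Union>k. E k)"
    using periodic[of "_ + v"]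
    by (auto simp: E_def add_lattice_point_in_unit_cube_iff) (auto simp: A_def to_torus_add)
  then have "emeasure torus_measure ((\<lambda>t. t + to_torus v) -` B) = emeasure lborel (\<Union>k. E k)"
    by (simp add: emeasure_torus[OF translate])
  also have "\<dots> = (\<integral>\<^sup>+k. emeasure lborel (E k) \<partial>count_space UNIV)"
    using E by (intro emeasure_UN_countable)
      (auto simp: disjoint_family_on_def E_def add_lattice_point_in_unit_cube_iff)
  also have "\<dots> = (\<integral>\<^sup>+k. emeasure lborel (F k) \<partial>count_space UNIV)"
    unfolding E_eq by (simp add: emeasure_lborel_translate F)
  also have "\<dots> = emeasure lborel (\<Union>k. F k)"
    using F by (intro emeasure_UN_countable[symmetric])
      (auto simp: disjoint_family_on_def F_def diff_lattice_point_in_unit_cube_iff)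
  also have "(\<Union>k. F k) = to_torus -` B \<inter> unit_cube"
    by (auto simp: F_def A_def diff_lattice_point_in_unit_cube_iff)
  finally show ?thesis by (simp add: emeasure_torus[OF B])
qed

lemma measure_torus_translate:
  fixes \<alpha> :: "circle ^ 'n::finite"
  assumes "B \<in> sets borel"
  shows "measure torus_measure (translation_action \<alpha> z -` B) = measure torus_measure B"
proof -
  obtain v where "int_mult z \<alpha> = to_torus v"
    using surj_to_torus by (metis surjD)
  moreover have "translation_action \<alpha> z = (\<lambda>t. t + int_mult z \<alpha>)"
    by (simp add: translation_action_def fun_eq_iff)
  ultimately show ?thesis
    using emeasure_torus_translate[OF assms, of v] by (simp add: measure_def)
qed

section \<open>Changes of symbol happen near the boundary\<close>

text \<open>
  The shortest segment from \<open>s\<close> to \<open>s'\<close> is connected and meets both \<open>U\<close> and its complement, so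
  it contains a frontier point.
\<close>

lemma frontier_between:
  fixes s :: "circle ^ 'n::finite"
  assumes differ: "(s \<in> U) \<noteq> (s' \<in> U)"
  shows "\<exists>c\<in>frontier U. dist s c \<le> dist s' s"
proof -
  obtain b where b: "to_torus b = s' - s" "norm b = dist (s' - s) 0"
    by (rule shortest_lift)
  define \<gamma> where "\<gamma> r = s + to_torus (r *\<^sub>R b)" for r
  have dist_\<gamma>: "dist (\<gamma> r) (\<gamma> r') \<le> dist (r *\<^sub>R b) (r' *\<^sub>R b)" for r r'
    unfolding \<gamma>_def dist_torus_translate by (rule dist_to_torus_le)
  have ends: "\<gamma> 0 = s" "\<gamma> 1 = s'"
    by (simp_all add: \<gamma>_def b to_torus_zero)
  have "continuous_on {0..1} \<gamma>"
    unfolding continuous_on_iff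
  proof (intro ballI allI impI)
    fix r e :: real
    assume "0 < e"
    have "continuous_on UNIV (\<lambda>r::real. r *\<^sub>R b)" by (intro continuous_intros)
    with \<open>0 < e\<close> obtain d where "d > 0" "\<forall>r'. dist r' r < d \<longrightarrow> dist (r' *\<^sub>R b) (r *\<^sub>R b) < e"
      unfolding continuous_on_iff by blast
    then show "\<exists>d>0. \<forall>r'\<in>{0..1}. dist r' r < d \<longrightarrow> dist (\<gamma> r') (\<gamma> r) < e"
      using dist_\<gamma> le_less_trans by blast
  qed
  then have "connected (\<gamma> ` {0..1})"
    by (intro connected_continuous_image) auto
  moreover have mem: "s \<in> \<gamma> ` {0..1}" "s' \<in> \<gamma> ` {0..1}"
    using ends by (auto simp: image_iff intro: bexI[of _ 0] bexI[of _ 1])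
  then have "\<gamma> ` {0..1} \<inter> U \<noteq> {}" "\<gamma> ` {0..1} - U \<noteq> {}"
    using differ by auto
  ultimately have "\<gamma> ` {0..1} \<inter> frontier U \<noteq> {}"
    by (rule connected_Int_frontier)
  then obtain r where r: "0 \<le> r" "r \<le> 1" "\<gamma> r \<in> frontier U"
    by auto
  have "dist s (\<gamma> r) \<le> dist (0 *\<^sub>R b) (r *\<^sub>R b)"
    using dist_\<gamma>[of 0 r] by (simp add: ends)
  also have "\<dots> \<le> norm b"
    using r by (simp add: mult_left_le_one_le)
  also have "\<dots> = dist s' s"
    using dist_torus_translate[of s "s' - s" 0] by (simp add: b)
  finally show ?thesis using r by blast
qed

text \<open>
  The symbol of a point, even of one outside both cells, is a function of its membership in each
  of them; so two points with different symbols are separated by some \<open>P a\<close>.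
\<close>

lemma itinerary_changes_near_boundary:
  fixes \<alpha> :: "circle ^ 'n::finite"
  assumes change: "itinerary (translation_action \<alpha>) P t l \<noteq>
      itinerary (translation_action \<alpha>) P t (l + z)"
    and close: "\<And>s. dist (translation_action \<alpha> z s) s < e"
  shows "\<exists>c\<in>partition_boundary P. dist (translation_action \<alpha> l t) c < e"
proof -
  let ?s = "translation_action \<alpha> l t" and ?s' = "translation_action \<alpha> (l + z) t"
  have "\<exists>a. (?s \<in> P a) \<noteq> (?s' \<in> P a)"
    using change unfolding itinerary_def by metis
  then obtain a c where "c \<in> frontier (P a)" "dist ?s c \<le> dist ?s' ?s"
    using frontier_between by blast
  moreover have "dist ?s' ?s < e"
    using close by (simp add: translation_action_add)
  moreover have "frontier (P a) \<subseteq> partition_boundary P"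
    by (cases a) (auto simp: partition_boundary_def)
  ultimately show ?thesis by force
qed

section \<open>Measure of the return sets\<close>

lemma sets_dyadic_return_set: "dyadic_return_set \<delta> m \<in> sets sequence_space"
proof -
  have "{a \<in> space sequence_space. \<forall>l::int. 0 \<le> l \<and> of_int l < \<delta> * 2 ^ m \<longrightarrow>
      (a l = 1) = (a (l + 2 ^ m) = 1)} \<in> sets sequence_space"
    by measurable
  moreover have "(x = 1) = (y = 1) \<longleftrightarrow> x = y" for x y :: bit
    by (cases x; cases y) auto
  ultimately show ?thesis
    by (simp add: dyadic_return_set_def space_PiM PiE_def)
qed

text \<open>A union bound over the at most \<open>\<delta>2\<^sup>m + 1\<close> times \<open>l\<close> that occur in the return set.\<close>

lemma measure_dyadic_return_set_ge:
  fixes \<alpha> :: "circle ^ 'n::finite"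
  assumes P: "open_partition P"
    and close: "\<And>t. dist (translation_action \<alpha> (2 ^ m) t) t < e"
    and \<delta>: "\<delta> > 0"
  shows "measure (partition_measure (translation_action \<alpha>) P) (dyadic_return_set \<delta> m) \<ge>
    1 - (\<delta> * 2 ^ m + 1) * measure torus_measure {t. \<exists>c\<in>partition_boundary P. dist t c < e}"
proof -
  interpret prob_space "torus_measure :: (circle ^ 'n) measure"
    by (rule prob_space_torus_measure)
  define N where "N = {t. \<exists>c\<in>partition_boundary P. dist t c < e}"
  define I where "I = {0..<\<lceil>\<delta> * 2 ^ m\<rceil>}"
  define G where "G = itinerary (translation_action \<alpha>) P -` dyadic_return_set \<delta> m"
  have N: "N \<in> sets borel"
  proof -
    have "N = (\<Union>c\<in>partition_boundary P. ball c e)"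
      by (auto simp: N_def dist_commute)
    then show ?thesis by (simp add: open_UN)
  qed
  have pre: "translation_action \<alpha> l -` N \<in> sets borel" for l
    using measurable_sets[OF borel_measurable_continuous_onI[OF continuous_on_translation_action] N]
    by simp
  have G: "G \<in> sets borel"
    using measurable_sets[OF measurable_itinerary[OF P] sets_dyadic_return_set]
    by (simp add: G_def)
  have "- G \<subseteq> (\<Union>l\<in>I. translation_action \<alpha> l -` N)"
  proof
    fix t
    assume "t \<in> - G"
    then obtain l :: int where "0 \<le> l" "of_int l < \<delta> * 2 ^ m"
      and change: "itinerary (translation_action \<alpha>) P t l \<noteq>
        itinerary (translation_action \<alpha>) P t (l + 2 ^ m)"
      by (auto simp: G_def dyadic_return_set_def)
    then have "l \<in> I"
      by (simp add: I_def less_ceiling_iff)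
    moreover have "translation_action \<alpha> l t \<in> N"
      using itinerary_changes_near_boundary[OF change close] by (simp add: N_def)
    ultimately show "t \<in> (\<Union>l\<in>I. translation_action \<alpha> l -` N)"
      by blast
  qed
  then have "prob (- G) \<le> prob (\<Union>l\<in>I. translation_action \<alpha> l -` N)"
    using pre by (intro finite_measure_mono) (auto simp: I_def)
  also have "\<dots> \<le> (\<Sum>l\<in>I. prob (translation_action \<alpha> l -` N))"
    using pre by (intro finite_measure_subadditive_finite) (auto simp: I_def)
  also have "\<dots> = real (card I) * prob N"
    by (simp add: measure_torus_translate[OF N])
  also have "\<dots> \<le> (\<delta> * 2 ^ m + 1) * prob N"
  proof (intro mult_right_mono)
    have "0 < \<delta> * 2 ^ m"
      using \<delta> by simp
    then show "real (card I) \<le> \<delta> * 2 ^ m + 1"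
      unfolding I_def card_atLeastLessThan_int by linarith
  qed simp
  finally have "1 - (\<delta> * 2 ^ m + 1) * prob N \<le> prob G"
    using prob_compl[of G] G by (simp add: Compl_eq_Diff_UNIV)
  also have "prob G = measure (partition_measure (translation_action \<alpha>) P) (dyadic_return_set \<delta> m)"
    unfolding partition_measure_def G_def
    by (simp add: measure_distr measurable_itinerary[OF P] sets_dyadic_return_set)
  finally show ?thesis by (simp add: N_def)
qed

lemma finite_L_content_bound:
  assumes "finite_L_content C"
  obtains M e\<^sub>0 where "M > 0" "e\<^sub>0 > 0"
    "\<And>e. \<lbrakk>0 < e; e < e\<^sub>0\<rbrakk> \<Longrightarrow> measure torus_measure {t. \<exists>c\<in>C. dist t c < e} \<le> 2 * M * e"
proof -
  obtain L where "((\<lambda>e. 1 / (2 * e) * measure torus_measure {t. \<exists>c\<in>C. dist t c < e}) \<longlongrightarrow> L)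
      (at_right 0)"
    using assms by (auto simp: finite_L_content_def has_L_content_def)
  then have "\<forall>\<^sub>F e in at_right 0.
      1 / (2 * e) * measure torus_measure {t. \<exists>c\<in>C. dist t c < e} < \<bar>L\<bar> + 1"
    by (rule order_tendstoD) simp
  then obtain e\<^sub>0 where "e\<^sub>0 > 0" and
    "\<And>e. \<lbrakk>0 < e; e < e\<^sub>0\<rbrakk> \<Longrightarrow>
      1 / (2 * e) * measure torus_measure {t. \<exists>c\<in>C. dist t c < e} < \<bar>L\<bar> + 1"
    by (auto simp: eventually_at_right_field)
  then show ?thesis
    by (intro that[of "\<bar>L\<bar> + 1" e\<^sub>0]) (force simp: field_simps)+
qed

theorem proposition15p2:
  fixes \<alpha> :: "circle ^ 'n::finite" and P :: "bit \<Rightarrow> (circle ^ 'n) set"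
  assumes "inj (\<lambda>z::int. int_mult z \<alpha>)"
    and "closure (range (\<lambda>z::int. int_mult z \<alpha>)) = UNIV"
    and "open_partition P"
    and "finite_L_content (partition_boundary P)"
    and "dyadically_recurrent_action (translation_action \<alpha>)"
  shows "dyadically_recurrent_measure (partition_measure (translation_action \<alpha>) P)"
proof -
  let ?\<mu> = "partition_measure (translation_action \<alpha>) P"
  let ?nbhd = "\<lambda>e. measure torus_measure {t. \<exists>c\<in>partition_boundary P. dist t c < e}"
  obtain n where n: "filterlim n at_top sequentially"
    and close: "\<And>k t. dist (translation_action \<alpha> (2 ^ n k) t) t < 1 / 2 ^ n k"
    using assms(5) by (auto simp: dyadically_recurrent_action_def)
  obtain M e\<^sub>0 where M: "M > 0" and e\<^sub>0: "e\<^sub>0 > 0"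
    and nbhd: "\<And>e. \<lbrakk>0 < e; e < e\<^sub>0\<rbrakk> \<Longrightarrow> ?nbhd e \<le> 2 * M * e"
    using finite_L_content_bound[OF assms(4)] by blast
  \<comment> \<open>With this choice the two terms \<open>2M\<delta>\<close> and \<open>2M/2\<^sup>m\<close> of the bound are each at most \<open>1/4\<close>.\<close>
  define \<delta> where "\<delta> = 1 / (8 * M)"
  have \<delta>: "\<delta> > 0" using M by (simp add: \<delta>_def)
  have "filterlim (\<lambda>k. 2 ^ n k :: real) at_top sequentially"
    by (rule filterlim_at_top_mono[OF filterlim_compose[OF filterlim_real_sequentially n]])
      (simp add: less_imp_le of_nat_less_two_power)
  then have "\<forall>\<^sub>F k in sequentially. max (8 * M) (1 / e\<^sub>0) < 2 ^ n k"
    unfolding filterlim_at_top_dense by blast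
  then obtain k\<^sub>0 where k\<^sub>0: "\<And>k. k \<ge> k\<^sub>0 \<Longrightarrow> max (8 * M) (1 / e\<^sub>0) < 2 ^ n k"
    by (auto simp: eventually_sequentially)
  have "measure ?\<mu> (dyadic_return_set \<delta> (n k)) > 1 / 4" if "k \<ge> k\<^sub>0" for k
  proof -
    have large: "8 * M < 2 ^ n k" "1 / 2 ^ n k < e\<^sub>0"
      using k\<^sub>0[OF that] e\<^sub>0 by (simp_all add: field_simps)
    have "(\<delta> * 2 ^ n k + 1) * ?nbhd (1 / 2 ^ n k) \<le> (\<delta> * 2 ^ n k + 1) * (2 * M * (1 / 2 ^ n k))"
      using \<delta> large by (intro mult_left_mono nbhd) auto
    also have "\<dots> = 1 / 4 + 2 * M / 2 ^ n k"
      using M by (simp add: \<delta>_def field_simps)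
    also have "\<dots> \<le> 1 / 2"
      using large by (simp add: field_simps)
    finally show ?thesis
      using measure_dyadic_return_set_ge[OF assms(3) close[of k] \<delta>] by linarith
  qed
  moreover have "filterlim (\<lambda>k. n (k + k\<^sub>0)) at_top sequentially"
    by (rule filterlim_compose[OF n filterlim_add_const_nat_at_top])
  ultimately show ?thesis
    unfolding dyadically_recurrent_measure_def using \<delta>
    by (intro exI[of _ "\<lambda>k. n (k + k\<^sub>0)"] exI[of _ "1/4"] exI[of _ \<delta>]) auto
qed

end
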